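(* For the class $\mathcal{C}$ of trees we have $\kappa=1$ and $\sigma^2=1$.
   Context: Graphs are finite, simple, undirected and vertex-labelled. $\mathcal{B}\subset\mathcal{C}$ is the subclass of graphs in $\mathcal{C}$ that are 2-connected (connected, at least three vertices, no cutvertex) or consist of a single edge with its two ends. $C(z)=\sum_n|\mathcal{C}_n|z^n/n!$ and $B(z)=\sum_n|\mathcal{B}_n|z^n/n!$ are the exponential generating functions (a subscript $n$ denotes the objects with vertex set $\{1,\dots,n\}$); $\rho$ is the radius of convergence of $C(z)$, $C^\bullet(z)=zC'(z)$ and $y=C^\bullet(\rho)$, which is the unique positive solution of $yB''(y)=1$. A $\mathcal{B}'^\bullet$-object on a finite set $U$ is a graph in $\mathcal{B}$ with vertex set $U\cup\{*\}$, $*\notin U$, together with a distinguished root vertex in $U$; its size $|\cdot|$ is $|U|$; the exponential generating function is $B'^\bullet(z)=zB''(z)$. The scaling factor is $\kappa=\mathbb{E}[\mathsf{sp}(\mathsf{B})]$, where $\mathsf{sp}(\mathsf{B})$ is the graph distance in $\mathsf{B}$ from $*$ to the root and $\mathsf{B}\in\mathcal{B}'^\bullet$ follows the Boltzmann distribution with parameter $y$: each object on label set $\{1,\dots,m\}$ has probability $y^m/(m!\,B'^\bullet(y))$. Also $\sigma^2=\mathbb{E}[|\mathsf{B}|]=1+B'''(y)y^2$. *)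

theory Defs
  imports "HOL-Analysis.Analysis" "Graph_Theory.Graph_Theory"
begin

text \<open>
  A finite simple undirected graph is a \<^locale>\<open>pair_graph\<close>: a finite vertex set with a symmetric,
  irreflexive arc relation, every undirected edge being the pair of its two orientations.
  A class of graphs is a set of graphs labelled by natural numbers. The vertex sets that are
  counted are \<open>{1..n}\<close>, so that \<open>0\<close> is never such a label and can serve as the vertex \<open>*\<close>.
\<close>

type_synonym lgraph = "nat pair_pre_digraph"

text \<open>
  The library predicate \<^const>\<open>tree\<close> cannot be used: in a symmetric digraph the closed walk
  \<open>u, v, u\<close> along a single edge is a \<^const>\<open>pre_digraph.cycle\<close>. A cycle of an undirected simple
  graph is one of length at least three.
\<close>

definition acyclic_graph :: "'a pair_pre_digraph \<Rightarrow> bool" where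
  "acyclic_graph G \<longleftrightarrow> \<not> (\<exists>p. pre_digraph.cycle (with_proj G) p \<and> length p \<ge> 3)"

definition trees :: "lgraph set" where
  "trees = {G. pair_graph G \<and> Digraph_Component.connected (with_proj G) \<and> acyclic_graph G}"


definition cutvertex :: "'a pair_pre_digraph \<Rightarrow> 'a \<Rightarrow> bool" where
  "cutvertex G v \<longleftrightarrow> v \<in> pverts G \<and>
     (\<exists>u \<in> pverts G - {v}. \<exists>w \<in> pverts G - {v}.
        u \<rightarrow>\<^sup>*\<^bsub>with_proj G\<^esub> w \<and> \<not> u \<rightarrow>\<^sup>*\<^bsub>pre_digraph.del_vert (with_proj G) v\<^esub> w)"

definition two_connected :: "'a pair_pre_digraph \<Rightarrow> bool" where
  "two_connected G \<longleftrightarrow> Digraph_Component.connected (with_proj G) \<and> card (pverts G) \<ge> 3 \<and>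
     (\<forall>v. \<not> cutvertex G v)"

definition single_edge :: "'a pair_pre_digraph \<Rightarrow> bool" where
  "single_edge G \<longleftrightarrow> (\<exists>u v. u \<noteq> v \<and> G = \<lparr>pverts = {u, v}, parcs = {(u, v), (v, u)}\<rparr>)"

definition blocks :: "lgraph set \<Rightarrow> lgraph set" where
  "blocks \<C> = {G \<in> \<C>. two_connected G \<or> single_edge G}"


definition egf :: "lgraph set \<Rightarrow> real fps" where
  "egf \<C> = Abs_fps (\<lambda>n. real (card {G \<in> \<C>. pverts G = {1..n}}) / fact n)"

definition pointed_egf :: "lgraph set \<Rightarrow> real fps" where
  "pointed_egf \<C> = fps_X * fps_deriv (egf \<C>)"

definition egf_radius :: "lgraph set \<Rightarrow> real" where
  "egf_radius \<C> = real_of_ereal (fps_conv_radius (egf \<C>))"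

text \<open>
  The radius is taken as a real number, hence is meaningful for classes with a finite radius of
  convergence. The parameter \<open>y\<close> is the value of the pointed series on the boundary of its
  disc of convergence.
\<close>

definition block_param :: "lgraph set \<Rightarrow> real" where
  "block_param \<C> = eval_fps (pointed_egf \<C>) (egf_radius \<C>)"

definition derived_pointed_block_egf :: "lgraph set \<Rightarrow> real fps" where
  "derived_pointed_block_egf \<C> = fps_X * fps_deriv (fps_deriv (egf (blocks \<C>)))"


text \<open>The derived and pointed blocks on a set \<open>U\<close> of positive labels; \<open>0\<close> plays the role of \<open>*\<close>.\<close>

definition derived_pointed_blocks :: "lgraph set \<Rightarrow> nat set \<Rightarrow> (lgraph \<times> nat) set" where
  "derived_pointed_blocks \<C> U = {(G, r). G \<in> blocks \<C> \<and> pverts G = insert 0 U \<and> r \<in> U}"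

definition obj_size :: "lgraph \<times> nat \<Rightarrow> nat" where
  "obj_size X = card (pverts (fst X) - {0})"

definition graph_dist :: "'a pair_pre_digraph \<Rightarrow> 'a \<Rightarrow> 'a \<Rightarrow> nat" where
  "graph_dist G u v = (LEAST n. \<exists>p. pre_digraph.awalk (with_proj G) u p v \<and> length p = n)"

definition sp :: "lgraph \<times> nat \<Rightarrow> nat" where
  "sp X = graph_dist (fst X) 0 (snd X)"

definition boltzmann :: "lgraph set \<Rightarrow> real \<Rightarrow> (lgraph \<times> nat) measure" where
  "boltzmann \<C> y = density (count_space (\<Union>m. derived_pointed_blocks \<C> {1..m}))
     (\<lambda>X. ennreal (y ^ obj_size X /
        (fact (obj_size X) * eval_fps (derived_pointed_block_egf \<C>) y)))"

definition scaling_factor :: "lgraph set \<Rightarrow> real" where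
  "scaling_factor \<C> = (\<integral>X. real (sp X) \<partial>boltzmann \<C> (block_param \<C>))"

definition sigma_squared :: "lgraph set \<Rightarrow> real" where
  "sigma_squared \<C> = (\<integral>X. real (obj_size X) \<partial>boltzmann \<C> (block_param \<C>))"

end

theory Submission
  imports Defs
begin

text \<open>
  A tree with at least three vertices has a vertex with two neighbours, and that vertex is a
  cutvertex. So the blocks of the class of trees are single edges, the Boltzmann distribution is
  concentrated on one object, and both expectations equal \<open>1\<close> as soon as \<open>y > 0\<close>.

  The value \<open>y\<close> is meaningful only if \<open>T(z) = z C'(z)\<close> converges at its radius of
  convergence \<open>\<rho>\<close>, with \<open>0 < \<rho> < \<infinity>\<close>. Encoding a tree by its parent function
  gives at most \<open>n ^ n\<close> trees on \<open>n\<close> vertices, hence \<open>\<rho> > 0\<close>, and shows that a tree has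
  at most \<open>2 * n\<close> arcs. Joining the roots of two rooted trees by an edge then gives
  \<open>T\<^sup>2 \<le> 2 T\<close> coefficientwise, so \<open>x \<le> T(x) \<le> 2\<close> wherever \<open>T\<close> converges at
  \<open>x \<ge> 0\<close>. Therefore \<open>\<rho> \<le> 2\<close>, and the bound on \<open>T\<close> below \<open>\<rho>\<close> forces
  convergence at \<open>\<rho>\<close>.
\<close>

subsection \<open>Trees as relations\<close>

text \<open>Acyclicity is expressed by the condition that every edge is a bridge.\<close>

definition tree_rel :: "'a set \<Rightarrow> 'a rel \<Rightarrow> bool" where
  "tree_rel V E \<longleftrightarrow> finite V \<and> V \<noteq> {} \<and> E \<subseteq> V \<times> V \<and> sym E \<and>
     (\<forall>u\<in>V. \<forall>v\<in>V. (u, v) \<in> E\<^sup>*) \<and>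
     (\<forall>u v. (u, v) \<in> E \<longrightarrow> (u, v) \<notin> (E - {(u, v), (v, u)})\<^sup>*)"

lemma tree_relD:
  assumes "tree_rel V E"
  shows "finite V" "V \<noteq> {}" "E \<subseteq> V \<times> V" "sym E"
    and "u \<in> V \<Longrightarrow> v \<in> V \<Longrightarrow> (u, v) \<in> E\<^sup>*"
    and "(u, v) \<in> E \<Longrightarrow> (u, v) \<notin> (E - {(u, v), (v, u)})\<^sup>*"
  using assms unfolding tree_rel_def by auto

text \<open>A loop is never a bridge, because the empty path already connects its two equal
  ends.\<close>

lemma tree_rel_irrefl: "tree_rel V E \<Longrightarrow> (u, u) \<notin> E"
  using tree_relD(6) by fastforce

lemma finite_tree_rels: "finite V \<Longrightarrow> finite {E. tree_rel V E}"
  by (rule finite_subset[of _ "Pow (V \<times> V)"]) (auto dest: tree_relD(3))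

section \<open>Translation between library graphs and relations\<close>

lemma reachable_with_proj_iff:
  assumes "parcs G \<subseteq> pverts G \<times> pverts G"
  shows "u \<rightarrow>\<^sup>*\<^bsub>with_proj G\<^esub> v \<longleftrightarrow> u \<in> pverts G \<and> (u, v) \<in> (parcs G)\<^sup>*"
proof -
  have "v \<in> pverts G" if "(u, v) \<in> (parcs G)\<^sup>*" "u \<in> pverts G"
    using that by (induction rule: rtrancl_induct) (use assms in auto)
  then have "(u, v) \<in> rtrancl_on (pverts G) (parcs G)"
    if "(u, v) \<in> (parcs G)\<^sup>*" "u \<in> pverts G"
    using that by (intro rtrancl_consistent_rtrancl_on) (use assms in auto)
  then show ?thesis
    by (auto simp: reachable_def dest: rtrancl_on_rtranclI in_rtrancl_on_in_F)
qed

text \<open>The library defines \<open>connected\<close> through \<open>mk_symmetric\<close>; this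
  reduces it to reachability in the graph itself.\<close>

lemma mk_symmetric_with_proj:
  assumes "sym (parcs G)"
  shows "mk_symmetric (with_proj G) = G"
proof -
  have "(\<Union>e\<in>parcs G. {(fst e, snd e), (snd e, fst e)}) = parcs G"
    using assms by (auto dest: symD)
  then show ?thesis
    by (simp add: mk_symmetric_def)
qed

lemma connected_with_proj_iff:
  assumes "sym (parcs G)" "parcs G \<subseteq> pverts G \<times> pverts G"
  shows "connected (with_proj G) \<longleftrightarrow>
    pverts G \<noteq> {} \<and> (\<forall>u\<in>pverts G. \<forall>v\<in>pverts G. (u, v) \<in> (parcs G)\<^sup>*)"
  using assms
  by (auto simp: connected_def mk_symmetric_with_proj strongly_connected_def reachable_with_proj_iff)

lemma pair_graph_iff:
  "pair_graph G \<longleftrightarrow> finite (pverts G) \<and> parcs G \<subseteq> pverts G \<times> pverts G \<and> sym (parcs G) \<and> irrefl (parcs G)"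
proof
  assume "pair_graph G"
  then interpret pair_graph G .
  show "finite (pverts G) \<and> parcs G \<subseteq> pverts G \<times> pverts G \<and> sym (parcs G) \<and> irrefl (parcs G)"
    using arcs_symmetric wellformed' no_loops'
    by (auto simp: sym_def irrefl_def pair_finite_verts) blast
next
  assume G: "finite (pverts G) \<and> parcs G \<subseteq> pverts G \<times> pverts G \<and> sym (parcs G) \<and> irrefl (parcs G)"
  then have "finite (parcs G)"
    by (meson finite_SigmaI finite_subset)
  with G show "pair_graph G"
    by unfold_locales (auto simp: symmetric_def irrefl_def)
qed

text \<open>A path from \<open>u\<close> to \<open>v\<close> that avoids the edge has at least two
  arcs, and the arc \<open>(v, u)\<close> closes it to a cycle of length at least three.\<close>

lemma acyclic_graphD:
  assumes G: "pair_graph G" and ac: "acyclic_graph G" and uv: "(u, v) \<in> parcs G"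
  shows "(u, v) \<notin> (parcs G - {(u, v), (v, u)})\<^sup>*"
proof
  let ?H = "\<lparr>pverts = pverts G, parcs = parcs G - {(u, v), (v, u)}\<rparr>"
  assume uv': "(u, v) \<in> (parcs G - {(u, v), (v, u)})\<^sup>*"
  interpret G: pair_graph G by fact
  have H: "parcs ?H \<subseteq> pverts ?H \<times> pverts ?H"
    using G.wellformed' by auto
  interpret H: pair_wf_digraph ?H
    using G.wellformed' by unfold_locales auto
  have "u \<rightarrow>\<^sup>*\<^bsub>with_proj ?H\<^esub> v"
    using uv' uv G.wellformed' by (subst reachable_with_proj_iff[OF H]) auto
  then obtain p where p: "H.apath u p v"
    using H.reachable_apath by blast
  have "u \<noteq> v"
    using uv G.no_loops' by blast
  then have "length p \<noteq> 0"
    using p by (auto simp: H.apath_simps)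
  \<comment> \<open>The only walk of length one from \<open>u\<close> to \<open>v\<close> is the arc
    \<open>(u, v)\<close>, which is missing in \<open>?H\<close>.\<close>
  moreover have "length p \<noteq> 1"
    using p by (auto simp: H.apath_simps length_Suc_conv)
  ultimately have len: "length p \<ge> 2"
    by linarith
  have "G.awalk u p v" "distinct (pawalk_verts u p)"
    using p by (auto simp: H.apath_def H.awalk_def G.awalk_def)
  then have "G.cycle ((v, u) # p)"
    unfolding G.cycle_def using uv G.arcs_symmetric[OF uv] 
    by (intro exI[of _ v]) (auto simp: G.awalk_simps)
  with ac len show False
    unfolding acyclic_graph_def by fastforce
qed

text \<open>Without its first arc \<open>(u, v)\<close>, a cycle is a path back from
  \<open>v\<close> to \<open>u\<close>. This path uses neither orientation of that edge, so the edge
  is not a bridge.\<close>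

lemma acyclic_graphI:
  assumes G: "pair_graph G"
    and bridge: "\<And>u v. (u, v) \<in> parcs G \<Longrightarrow> (u, v) \<notin> (parcs G - {(u, v), (v, u)})\<^sup>*"
  shows "acyclic_graph G"
  unfolding acyclic_graph_def
proof safe
  interpret G: pair_graph G by fact
  fix p assume "G.cycle p" and len: "3 \<le> length p"
  then obtain u where w: "G.awalk u p u" and d: "distinct (tl (pawalk_verts u p))"
    unfolding G.cycle_def by blast
  obtain v q where p: "p = (u, v) # q"
    using w len by (cases p) (auto simp: G.awalk_simps)
  have uv: "(u, v) \<in> parcs G" and q: "G.awalk v q u" "distinct (pawalk_verts v q)" and "length q \<ge> 2"
    using w d len by (auto simp: p G.awalk_simps)
  have "set q \<inter> {(u, v), (v, u)} = {}"
  proof -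
    \<comment> \<open>Otherwise the part of the path that starts with this arc would be a nonempty
      path from \<open>u\<close> to \<open>u\<close>.\<close>
    have "(u, v) \<notin> set q"
    proof
      assume "(u, v) \<in> set q"
      then obtain q1 q2 where q12: "q = q1 @ (u, v) # q2"
        by (meson split_list)
      have "G.apath v (q1 @ (u, v) # q2) u"
        using q by (simp add: G.apath_def q12)
      then have "G.apath u ((u, v) # q2) u"
        by (auto simp: G.apath_append_iff G.apath_Cons_iff)
      then show False
        using G.apath_nonempty_ends by blast
    qed
    \<comment> \<open>Otherwise the parts before and after this arc are closed paths, hence empty,
      and the whole cycle is the walk \<open>u, v, u\<close>. This is where length at least three
      enters.\<close>
    moreover have "(v, u) \<notin> set q"
    proof
      assume "(v, u) \<in> set q"
      then obtain q1 q2 where q12: "q = q1 @ (v, u) # q2"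
        by (meson split_list)
      have ap: "G.apath v (q1 @ (v, u) # q2) u"
        using q by (simp add: G.apath_def q12)
      then have "G.apath u q2 u" "G.apath v q1 v"
        by (auto simp: G.apath_append_iff G.apath_Cons_iff)
      then have "q1 = []" "q2 = []"
        using G.apath_nonempty_ends by blast+
      with q12 \<open>length q \<ge> 2\<close> show False
        by simp
    qed
    ultimately show ?thesis by blast
  qed
  have "(x, y) \<in> (parcs G - {(u, v), (v, u)})\<^sup>*"
    if "G.awalk x q y" "set q \<inter> {(u, v), (v, u)} = {}" for x y q
    using that
  proof (induction q arbitrary: x)
    case Nil
    then show ?case by (simp add: G.awalk_simps)
  next
    case (Cons e q)
    then show ?case
      by (cases e) (auto simp: G.awalk_simps intro: converse_rtrancl_into_rtrancl)
  qed
  from this[OF q(1) \<open>set q \<inter> _ = {}\<close>] have "(v, u) \<in> (parcs G - {(v, u), (u, v)})\<^sup>*"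
    by (simp add: insert_commute)
  then show False
    using bridge[of v u] G.arcs_symmetric[OF uv] by blast
qed

lemma trees_iff_tree_rel: "G \<in> trees \<longleftrightarrow> tree_rel (pverts G) (parcs G)"
proof
  assume "G \<in> trees"
  then have G: "pair_graph G" "connected (with_proj G)" "acyclic_graph G"
    by (auto simp: trees_def)
  then show "tree_rel (pverts G) (parcs G)"
    using acyclic_graphD[OF G(1,3)] connected_with_proj_iff[of G]
    by (auto simp: tree_rel_def pair_graph_iff)
next
  assume T: "tree_rel (pverts G) (parcs G)"
  then have "pair_graph G"
    by (auto simp: pair_graph_iff irrefl_def tree_rel_irrefl dest: tree_relD)
  moreover from this have "acyclic_graph G"
    using tree_relD(6)[OF T] by (rule acyclic_graphI)
  moreover have "connected (with_proj G)"
    using T by (subst connected_with_proj_iff) (auto dest: tree_relD)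
  ultimately show "G \<in> trees"
    by (simp add: trees_def)
qed

section \<open>Blocks of the class of trees\<close>

lemma exists_two_neighbours:
  assumes T: "tree_rel V E" and "card V \<ge> 3"
  obtains u v w where "(v, u) \<in> E" "(v, w) \<in> E" "u \<noteq> w"
proof (rule ccontr)
  assume "\<not> thesis"
  then have uniq: "u = w" if "(v, u) \<in> E" "(v, w) \<in> E" for u v w
    using that by (meson \<open>\<And>w v u. \<lbrakk>(v, u) \<in> E; (v, w) \<in> E; u \<noteq> w\<rbrakk> \<Longrightarrow> thesis\<close>)
  obtain u where u: "u \<in> V"
    using tree_relD(2)[OF T] by blast
  \<comment> \<open>If every vertex has at most one neighbour, no walk from \<open>u\<close> gets
    beyond \<open>u\<close> and its neighbour.\<close>
  have "\<exists>w. V \<subseteq> {u, w}"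
  proof (cases "\<exists>w. (u, w) \<in> E")
    case True
    then obtain w where w: "(u, w) \<in> E" "(w, u) \<in> E"
      using tree_relD(4)[OF T] by (auto dest: symD)
    have "z \<in> {u, w}" if "(u, z) \<in> E\<^sup>*" for z
      using that by (induction rule: rtrancl_induct) (use w uniq in blast)+
    then show ?thesis
      using tree_relD(5)[OF T u] by blast
  next
    case False
    then have "z = u" if "(u, z) \<in> E\<^sup>*" for z
      using that by (metis converse_rtranclE)
    then show ?thesis
      using tree_relD(5)[OF T u] by blast
  qed
  then obtain w where "V \<subseteq> {u, w}" ..
  then have "card V \<le> card {u, w}"
    by (intro card_mono) auto
  also have "\<dots> \<le> 2"
    by (simp add: card_insert_if)
  finally show False
    using assms(2) by simp
qed

text \<open>The middle vertex \<open>v\<close> of a path \<open>u, v, w\<close> is a cutvertex: a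
  connection from \<open>u\<close> to \<open>w\<close> avoiding \<open>v\<close>, followed by the
  arc \<open>(w, v)\<close>, would bypass the bridge between \<open>u\<close> and
  \<open>v\<close>.\<close>

lemma tree_not_two_connected:
  assumes "G \<in> trees"
  shows "\<not> two_connected G"
proof
  assume "two_connected G"
  then have card: "card (pverts G) \<ge> 3" and nocut: "\<And>v. \<not> cutvertex G v"
    by (auto simp: two_connected_def)
  from assms have T: "tree_rel (pverts G) (parcs G)"
    by (simp add: trees_iff_tree_rel)
  from exists_two_neighbours[OF T card] obtain u v w
    where *: "(v, u) \<in> parcs G" "(v, w) \<in> parcs G" "u \<noteq> w" .
  have E: "parcs G \<subseteq> pverts G \<times> pverts G" and s: "sym (parcs G)"
    using T by (auto dest: tree_relD)
  have "u \<noteq> v" "w \<noteq> v"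
    using * tree_rel_irrefl[OF T] by auto
  have V: "u \<in> pverts G" "v \<in> pverts G" "w \<in> pverts G"
    using * E by auto
  have "u \<rightarrow>\<^sup>*\<^bsub>with_proj G\<^esub> w"
    using V tree_relD(5)[OF T] by (simp add: reachable_with_proj_iff[OF E])
  then have "u \<rightarrow>\<^sup>*\<^bsub>pre_digraph.del_vert (with_proj G) v\<^esub> w"
    using nocut[of v] V \<open>u \<noteq> v\<close> \<open>w \<noteq> v\<close> by (auto simp: cutvertex_def)
  then have "(u, w) \<in> (arcs_ends (pre_digraph.del_vert (with_proj G) v))\<^sup>*"
    by (auto simp: reachable_def dest: rtrancl_on_rtranclI)
  moreover have "arcs_ends (pre_digraph.del_vert (with_proj G) v) \<subseteq> parcs G - {(u, v), (v, u)}"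
    by (auto simp: pre_digraph.del_vert_def arcs_ends_def arc_to_ends_def)
  ultimately have "(u, w) \<in> (parcs G - {(u, v), (v, u)})\<^sup>*"
    by (meson rtrancl_mono subsetD)
  moreover have "(w, v) \<in> parcs G - {(u, v), (v, u)}"
    using * s \<open>w \<noteq> v\<close> by (auto dest: symD)
  ultimately have "(u, v) \<in> (parcs G - {(u, v), (v, u)})\<^sup>*"
    by (rule rtrancl_into_rtrancl)
  moreover have "(u, v) \<in> parcs G"
    using * s by (auto dest: symD)
  ultimately show False
    using tree_relD(6)[OF T] by blast
qed

lemma tree_rel_edge: "u \<noteq> v \<Longrightarrow> tree_rel {u, v} {(u, v), (v, u)}"
  by (auto simp: tree_rel_def sym_def)

lemma blocks_trees:
  "blocks trees = {\<lparr>pverts = {u, v}, parcs = {(u, v), (v, u)}\<rparr> | u v. u \<noteq> v}"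
  by (auto simp: blocks_def single_edge_def tree_not_two_connected trees_iff_tree_rel tree_rel_edge)

subsection \<open>Joining and counting trees\<close>

text \<open>Steps outside \<open>A\<close> and across the new edge become stationary at \<open>a\<close> under the retraction
  onto \<open>A\<close>, so a detour around an arc of the first tree would already exist inside it.\<close>

lemma bridge_join:
  assumes E1: "E1 \<subseteq> A \<times> A" and E2: "E2 \<subseteq> B \<times> B" and AB: "A \<inter> B = {}"
    and ab: "a \<in> A" "b \<in> B" and uv: "u \<in> A" "v \<in> A"
    and path: "(u, v) \<in> (E1 \<union> E2 \<union> {(a, b), (b, a)} - {(u, v), (v, u)})\<^sup>*"
  shows "(u, v) \<in> (E1 - {(u, v), (v, u)})\<^sup>*"
proof -
  define f where "f x = (if x \<in> A then x else a)" for x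
  have retract: "(f x, f y) \<in> (E1 - {(u, v), (v, u)})\<^sup>*"
    if "(x, y) \<in> E1 \<union> E2 \<union> {(a, b), (b, a)} - {(u, v), (v, u)}" for x y
    using that E1 E2 AB ab by (auto simp: f_def)
  have "(f x, f y) \<in> (E1 - {(u, v), (v, u)})\<^sup>*"
    if "(x, y) \<in> (E1 \<union> E2 \<union> {(a, b), (b, a)} - {(u, v), (v, u)})\<^sup>*" for x y
    using that
  proof (induction rule: rtrancl_induct)
    case (step y z)
    show ?case
      using step.IH retract[OF step.hyps(2)] by (rule rtrancl_trans)
  qed simp
  from this[OF path] uv show ?thesis
    by (simp add: f_def)
qed

lemma rtrancl_disjoint_Un:
  assumes "E1 \<subseteq> A \<times> A" "E2 \<subseteq> B \<times> B" "A \<inter> B = {}" "a \<in> A" "(a, x) \<in> (E1 \<union> E2)\<^sup>*"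
  shows "x \<in> A"
  using assms(5) by (induction rule: rtrancl_induct) (use assms(1-4) in auto)

text \<open>Old edges remain bridges by \<open>bridge_join\<close>. The new edge is a bridge because
  without it no walk leaves the vertex set it starts in.\<close>

lemma tree_rel_join:
  assumes T1: "tree_rel A E1" and T2: "tree_rel B E2" and AB: "A \<inter> B = {}"
    and ab: "a \<in> A" "b \<in> B"
  shows "tree_rel (A \<union> B) (E1 \<union> E2 \<union> {(a, b), (b, a)})"
proof -
  let ?E = "E1 \<union> E2 \<union> {(a, b), (b, a)}"
  note t1 = tree_relD[OF T1] and t2 = tree_relD[OF T2]
  have c1: "(x, y) \<in> ?E\<^sup>*" if "x \<in> A" "y \<in> A" for x y
    using t1(5)[OF that] rtrancl_mono[of E1 ?E] by auto
  have c2: "(x, y) \<in> ?E\<^sup>*" if "x \<in> B" "y \<in> B" for x y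
    using t2(5)[OF that] rtrancl_mono[of E2 ?E] by auto
  have "(a, b) \<in> ?E\<^sup>*" "(b, a) \<in> ?E\<^sup>*"
    by auto
  then have c3: "(x, y) \<in> ?E\<^sup>*" "(y, x) \<in> ?E\<^sup>*" if "x \<in> A" "y \<in> B" for x y
    using c1[OF that(1) ab(1)] c1[OF ab(1) that(1)] c2[OF that(2) ab(2)] c2[OF ab(2) that(2)]
    by (meson rtrancl_trans)+
  have "(u, v) \<notin> (?E - {(u, v), (v, u)})\<^sup>*" if uv: "(u, v) \<in> ?E" for u v
  proof
    assume path: "(u, v) \<in> (?E - {(u, v), (v, u)})\<^sup>*"
    consider "(u, v) \<in> E1" | "(u, v) \<in> E2" | "(u, v) = (a, b)" | "(u, v) = (b, a)"
      using uv by blast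
    then show False
    proof cases
      case 1
      then show False
        using bridge_join[OF t1(3) t2(3) AB ab _ _ path] t1(3,6) by blast
    next
      case 2
      \<comment> \<open>The two trees swap roles, so that the retraction is now onto
        \<open>B\<close>.\<close>
      have "?E = E2 \<union> E1 \<union> {(b, a), (a, b)}"
        by auto
      then show False
        using bridge_join[OF t2(3) t1(3) _ ab(2,1), of u v] AB path 2 t2(3,6) by auto
    next
      case 3
      have "(a, b) \<in> (E1 \<union> E2)\<^sup>*"
        using path 3 rtrancl_mono[of "?E - {(a, b), (b, a)}" "E1 \<union> E2"] by auto
      then have "b \<in> A"
        using rtrancl_disjoint_Un[OF t1(3) t2(3) AB ab(1)] by blast
      with ab AB show False by blast
    next
      case 4
      have "(b, a) \<in> (E2 \<union> E1)\<^sup>*"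
        using path 4 rtrancl_mono[of "?E - {(b, a), (a, b)}" "E2 \<union> E1"] by auto
      then have "a \<in> B"
        using rtrancl_disjoint_Un[OF t2(3) t1(3) _ ab(2)] AB by blast
      with ab AB show False by blast
    qed
  qed
  then show ?thesis
    unfolding tree_rel_def using t1(1-4) t2(1-4) ab c1 c2 c3
    by (auto simp: sym_def)
qed

text \<open>The marked new edge determines the splitting: once it is deleted, the component of
  \<open>a\<close> is \<open>A\<close>. This makes joining injective.\<close>

lemma join_component:
  assumes T1: "tree_rel A E1" and T2: "tree_rel B E2" and AB: "A \<inter> B = {}"
    and ab: "a \<in> A" "b \<in> B"
  shows "{x. (a, x) \<in> (E1 \<union> E2 \<union> {(a, b), (b, a)} - {(a, b), (b, a)})\<^sup>*} = A"
proof -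
  note t1 = tree_relD[OF T1] and t2 = tree_relD[OF T2]
  have "E1 \<union> E2 \<union> {(a, b), (b, a)} - {(a, b), (b, a)} = E1 \<union> E2"
    using t1(3) t2(3) AB ab by auto
  moreover have "(a, x) \<in> (E1 \<union> E2)\<^sup>*" if "x \<in> A" for x
    using t1(5)[OF ab(1) that] rtrancl_mono[of E1 "E1 \<union> E2"] by auto
  ultimately show ?thesis
    using rtrancl_disjoint_Un[OF t1(3) t2(3) AB ab(1)] by auto
qed

text \<open>Paths are pushed forward along \<open>f\<close> for connectedness, and a detour around
  an image edge is pulled back along the inverse of \<open>f\<close>.\<close>

lemma tree_rel_image:
  assumes T: "tree_rel V E" and f: "inj_on f V"
  shows "tree_rel (f ` V) (map_prod f f ` E)"
proof -
  note t = tree_relD[OF T]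
  have path: "(f x, f y) \<in> (map_prod f f ` F)\<^sup>*" if "(x, y) \<in> F\<^sup>*" for x y F
    using that by (induction rule: rtrancl_induct) (auto intro: rtrancl_into_rtrancl)
  let ?g = "the_inv_into V f"
  have g: "?g (f x) = x" if "x \<in> V" for x
    using f that by (simp add: the_inv_into_f_f)
  have "(f u, f v) \<notin> (map_prod f f ` E - {(f u, f v), (f v, f u)})\<^sup>*" if uv: "(u, v) \<in> E" for u v
  proof
    assume "(f u, f v) \<in> (map_prod f f ` E - {(f u, f v), (f v, f u)})\<^sup>*"
    moreover have "(?g x, ?g y) \<in> (E - {(u, v), (v, u)})\<^sup>*"
      if "(x, y) \<in> (map_prod f f ` E - {(f u, f v), (f v, f u)})\<^sup>*" for x y
      using that
    proof (induction rule: rtrancl_induct)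
      case (step y z)
      then obtain y' z' where "y = f y'" "z = f z'" "(y', z') \<in> E - {(u, v), (v, u)}"
        by auto
      moreover from this have "y' \<in> V" "z' \<in> V"
        using t(3) by auto
      ultimately show ?case
        using step.IH by (auto simp: g intro: rtrancl_into_rtrancl)
    qed auto
    ultimately have "(?g (f u), ?g (f v)) \<in> (E - {(u, v), (v, u)})\<^sup>*"
      by blast
    moreover have "u \<in> V" "v \<in> V"
      using uv t(3) by auto
    ultimately show False
      using t(6)[OF uv] by (simp add: g)
  qed
  then have "(x, y) \<notin> (map_prod f f ` E - {(x, y), (y, x)})\<^sup>*" if "(x, y) \<in> map_prod f f ` E" for x y
    using that by auto
  moreover have "sym (map_prod f f ` E)"
    using t(4) by (force simp: sym_def)
  moreover have "map_prod f f ` E \<subseteq> f ` V \<times> f ` V"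
    using t(3) by auto
  moreover have "\<forall>u\<in>f ` V. \<forall>v\<in>f ` V. (u, v) \<in> (map_prod f f ` E)\<^sup>*"
    using t(5) path by blast
  ultimately show ?thesis
    unfolding tree_rel_def using t(1,2) by blast
qed

section \<open>Counting labelled trees\<close>

definition num_trees :: "nat \<Rightarrow> nat" where
  "num_trees n = card {E. tree_rel {1..n} E}"

text \<open>Relabelling arcs is injective on relations inside \<open>V \<times> V\<close>. Applied
  to a bijection and to its inverse, this shows that the count depends on \<open>card V\<close>
  only.\<close>

lemma card_tree_rels_le:
  assumes "finite V" "inj_on f V"
  shows "card {E. tree_rel V E} \<le> card {E. tree_rel (f ` V) E}"
proof (rule card_inj_on_le[of "(`) (map_prod f f)"])
  show "inj_on ((`) (map_prod f f)) {E. tree_rel V E}"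
  proof (rule inj_on_subset)
    show "inj_on ((`) (map_prod f f)) (Pow (V \<times> V))"
      using assms(2) by (intro inj_on_image_Pow map_prod_inj_on)
  qed (auto dest: tree_relD(3))
qed (use assms in \<open>auto intro: tree_rel_image finite_tree_rels\<close>)

lemma card_tree_rels:
  assumes "finite V"
  shows "card {E. tree_rel V E} = num_trees (card V)"
proof -
  obtain f where f: "bij_betw f V {1..card V}"
    using assms by (metis finite_same_card_bij card_atLeastAtMost finite_atLeastAtMost diff_Suc_1)
  then have g: "bij_betw (the_inv_into V f) {1..card V} V"
    by (rule bij_betw_the_inv_into)
  have "card {E. tree_rel V E} \<le> num_trees (card V)"
    using card_tree_rels_le[OF assms, of f] f by (simp add: bij_betw_def num_trees_def)
  moreover have "num_trees (card V) \<le> card {E. tree_rel V E}"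
    using card_tree_rels_le[OF _ bij_betw_imp_inj_on[OF g]] g
    by (simp add: bij_betw_def num_trees_def)
  ultimately show ?thesis by simp
qed

text \<open>The edges from the vertices in \<open>W\<close> to their parents, in both orientations.
  In use, \<open>W\<close> consists of all vertices except the root.\<close>

definition parent_rel :: "'a set \<Rightarrow> ('a \<Rightarrow> 'a) \<Rightarrow> 'a rel" where
  "parent_rel W p = (\<lambda>v. (v, p v)) ` W \<union> (\<lambda>v. (p v, v)) ` W"

text \<open>The parent of \<open>v\<close> is a neighbour closer to the root. The parent edges alone
  connect \<open>V\<close>, so any further edge could be bypassed and would not be a bridge.\<close>

lemma tree_rel_parent:
  assumes T: "tree_rel V E" and r: "r \<in> V"
  obtains p where "p \<in> (V - {r}) \<rightarrow>\<^sub>E V" "E = parent_rel (V - {r}) p"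
proof -
  note t = tree_relD[OF T]
  \<comment> \<open>The distance from the root; the minimum exists for vertices in \<open>V\<close>
    by connectedness.\<close>
  define d where "d v = (LEAST n. (r, v) \<in> E ^^ n)" for v
  have "\<exists>u. (u, v) \<in> E \<and> d u < d v" if v: "v \<in> V - {r}" for v
  proof -
    have "\<exists>n. (r, v) \<in> E ^^ n"
      using t(5)[of r v] r v rtrancl_power by blast
    then have rv: "(r, v) \<in> E ^^ d v"
      unfolding d_def by (rule LeastI_ex)
    then obtain k where k: "d v = Suc k"
      using v by (cases "d v") auto
    with rv obtain u where u: "(r, u) \<in> E ^^ k" "(u, v) \<in> E"
      by auto
    then have "d u \<le> k"
      unfolding d_def by (simp add: Least_le)
    with k u show ?thesis by auto
  qed
  then obtain q where q: "(q v, v) \<in> E" "d (q v) < d v" if "v \<in> V - {r}" for v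
    by metis
  \<comment> \<open>The restriction makes \<open>p\<close> extensional, so that it lies in a finite
    function space that can be counted.\<close>
  define p where "p = restrict q (V - {r})"
  have p: "(p v, v) \<in> E" "d (p v) < d v" if "v \<in> V - {r}" for v
    using q[OF that] that by (auto simp: p_def)
  let ?H = "parent_rel (V - {r}) p"
  have sub: "?H \<subseteq> E"
    using p(1) t(4) by (auto simp: parent_rel_def dest: symD)
  have s: "sym ?H"
    by (auto simp: parent_rel_def sym_def)
  have root: "(v, r) \<in> ?H\<^sup>*" if "v \<in> V" for v
    using that
  proof (induction "d v" arbitrary: v rule: less_induct)
    case less
    show ?case
    proof (cases "v = r")
      case False
      with less.prems have v: "v \<in> V - {r}" by simp
      then have "(v, p v) \<in> ?H" "p v \<in> V"
        using p(1)[OF v] t(3) by (auto simp: parent_rel_def)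
      then show ?thesis
        using less.hyps[OF p(2)[OF v]] by (blast intro: converse_rtrancl_into_rtrancl)
    qed auto
  qed
  have conn: "(u, v) \<in> ?H\<^sup>*" if "u \<in> V" "v \<in> V" for u v
    using root[OF that(1)] root[OF that(2)] sym_rtrancl[OF s] by (meson rtrancl_trans symD)
  have "E \<subseteq> ?H"
  proof safe
    fix u v assume uv: "(u, v) \<in> E"
    show "(u, v) \<in> ?H"
    proof (rule ccontr)
      assume "(u, v) \<notin> ?H"
      then have "?H \<subseteq> E - {(u, v), (v, u)}"
        using sub s by (auto dest: symD)
      moreover have "(u, v) \<in> ?H\<^sup>*"
        using conn uv t(3) by blast
      ultimately have "(u, v) \<in> (E - {(u, v), (v, u)})\<^sup>*"
        by (meson rtrancl_mono subsetD)
      with t(6)[OF uv] show False ..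
    qed
  qed
  moreover have "p \<in> (V - {r}) \<rightarrow>\<^sub>E V"
    using p(1) t(3) by (auto simp: p_def)
  ultimately show thesis
    using that sub by blast
qed

text \<open>Each non-root vertex contributes the two orientations of the edge to its parent.\<close>

lemma card_tree_rel_le:
  assumes T: "tree_rel V E"
  shows "card E \<le> 2 * card V"
proof -
  obtain r where r: "r \<in> V"
    using tree_relD(2)[OF T] by blast
  obtain p where "E = parent_rel (V - {r}) p"
    using tree_rel_parent[OF T r] .
  then have "card E \<le> card (V - {r}) + card (V - {r})"
    unfolding parent_rel_def using tree_relD(1)[OF T]
    by (auto intro!: order_trans[OF card_Un_le] add_mono card_image_le)
  also have "\<dots> \<le> 2 * card V"
    using card_mono[of V "V - {r}"] tree_relD(1)[OF T] by simp
  finally show ?thesis .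
qed

text \<open>With vertex \<open>1\<close> as root, every tree comes from one of the
  \<open>n ^ (n - 1)\<close> parent functions. For \<open>n = 0\<close> there is no tree, since
  vertex sets are nonempty.\<close>

lemma num_trees_le: "num_trees n \<le> n ^ n"
proof (cases "n = 0")
  case True
  then show ?thesis
    by (simp add: num_trees_def tree_rel_def)
next
  case False
  let ?F = "({1..n} - {1}) \<rightarrow>\<^sub>E {1..n}"
  have fin: "finite ?F"
    by (intro finite_PiE) auto
  have "{E. tree_rel {1..n} E} \<subseteq> parent_rel ({1..n} - {1}) ` ?F"
  proof safe
    fix E assume "tree_rel {1..n} E"
    then obtain p where "p \<in> ?F" "E = parent_rel ({1..n} - {1}) p"
      using tree_rel_parent[of "{1..n}" E 1] False by auto
    then show "E \<in> parent_rel ({1..n} - {1}) ` ?F" by blast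
  qed
  then have "num_trees n \<le> card ?F"
    unfolding num_trees_def using fin by (rule surj_card_le[rotated])
  also have "\<dots> = n ^ (n - 1)"
    using False by (subst card_PiE) auto
  also have "\<dots> \<le> n ^ n"
    using False by (intro power_increasing) auto
  finally show ?thesis .
qed

lemma sum_Pow_card:
  fixes g :: "nat \<Rightarrow> 'b::comm_semiring_1"
  assumes "finite V"
  shows "(\<Sum>A\<in>Pow V. g (card A)) = (\<Sum>k\<le>card V. of_nat (card V choose k) * g k)"
proof -
  have "(\<Sum>A\<in>Pow V. g (card A)) = (\<Sum>k\<le>card V. \<Sum>A | A \<in> Pow V \<and> card A = k. g (card A))"
    using assms by (intro sum.group[symmetric]) (auto intro: card_mono)
  also have "\<dots> = (\<Sum>k\<le>card V. \<Sum>A | A \<in> Pow V \<and> card A = k. g k)"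
    by (intro sum.cong) auto
  also have "\<dots> = (\<Sum>k\<le>card V. of_nat (card V choose k) * g k)"
    using n_subsets[OF assms] by simp
  finally show ?thesis .
qed

text \<open>Two rooted trees on complementary vertex sets, joined by an edge between their roots, form a
  tree together with one of its at most \<open>2 * n\<close> arcs.\<close>

lemma num_trees_convolution:
  "(\<Sum>k\<le>n. (n choose k) * (k * num_trees k * ((n - k) * num_trees (n - k))))
     \<le> 2 * (n * num_trees n)"
proof -
  define V where "V = {1..n}"
  define T where "T = (\<lambda>A :: nat set. {E. tree_rel A E})"
  have [simp]: "finite V" "card V = n"
    by (auto simp: V_def)
  define D where "D = (SIGMA A:Pow V. (T A \<times> A) \<times> (T (V - A) \<times> (V - A)))"
  define J where "J = (\<lambda>(A :: nat set, (E1 :: nat rel, a :: nat), (E2 :: nat rel, b :: nat)).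
    (E1 \<union> E2 \<union> {(a, b), (b, a)}, (a, b)))"
  \<comment> \<open>The left inverse of \<open>J\<close>: delete the marked edge, take the component
    of \<open>a\<close> as the first vertex set, and restrict the arcs to both sides.\<close>
  define K where "K = (\<lambda>(E :: nat rel, (a, b)). let A = {x. (a, x) \<in> (E - {(a, b), (b, a)})\<^sup>*} in
    (A, (E \<inter> A \<times> A, a), (E \<inter> (V - A) \<times> (V - A), b)))"
  have fin: "finite (T A)" if "finite A" for A
    using that by (simp add: T_def finite_tree_rels)
  have card_T: "card (T A) = num_trees (card A)" if "finite A" for A
    using that by (simp add: T_def card_tree_rels)
  have KJ: "K (J x) = x" if "x \<in> D" for x
  proof -
    from that obtain A E1 a E2 b where x: "x = (A, (E1, a), (E2, b))" and "A \<subseteq> V"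
      and T1: "tree_rel A E1" "a \<in> A" and T2: "tree_rel (V - A) E2" "b \<in> V - A"
      by (auto simp: D_def T_def)
    have AB: "A \<inter> (V - A) = {}"
      by auto
    show ?thesis
      unfolding x J_def K_def Let_def prod.case join_component[OF T1(1) T2(1) AB T1(2) T2(2)]
      using tree_relD(3)[OF T1(1)] tree_relD(3)[OF T2(1)] T1(2) T2(2) by auto
  qed
  have JD: "J x \<in> (SIGMA E:T V. E)" if "x \<in> D" for x
  proof -
    from that obtain A E1 a E2 b where x: "x = (A, (E1, a), (E2, b))" and "A \<subseteq> V"
      and T1: "tree_rel A E1" "a \<in> A" and T2: "tree_rel (V - A) E2" "b \<in> V - A"
      by (auto simp: D_def T_def)
    have "A \<union> (V - A) = V"
      using \<open>A \<subseteq> V\<close> by auto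
    then show ?thesis
      using tree_rel_join[OF T1(1) T2(1) _ T1(2) T2(2)] by (auto simp: x J_def T_def)
  qed
  have finE: "finite E" if "E \<in> T V" for E
    using that tree_relD(1,3)[of V E] by (auto simp: T_def intro: finite_subset)
  have "card D = (\<Sum>A\<in>Pow V. card ((T A \<times> A) \<times> (T (V - A) \<times> (V - A))))"
    unfolding D_def
    by (intro card_SigmaI) (auto intro!: finite_cartesian_product fin intro: finite_subset[of _ V])
  also have "\<dots> = (\<Sum>A\<in>Pow V. card A * num_trees (card A) * ((n - card A) * num_trees (n - card A)))"
  proof (intro sum.cong refl)
    fix A assume "A \<in> Pow V"
    then have "finite A" "card (V - A) = n - card A"
      by (auto intro: finite_subset simp: card_Diff_subset finite_subset[of A V])
    then show "card ((T A \<times> A) \<times> (T (V - A) \<times> (V - A)))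
      = card A * num_trees (card A) * ((n - card A) * num_trees (n - card A))"
      by (simp add: card_T card_cartesian_product mult_ac)
  qed
  also have "\<dots> = (\<Sum>k\<le>n. (n choose k) * (k * num_trees k * ((n - k) * num_trees (n - k))))"
    using sum_Pow_card[of V "\<lambda>k. k * num_trees k * ((n - k) * num_trees (n - k))"] by simp
  finally have "(\<Sum>k\<le>n. (n choose k) * (k * num_trees k * ((n - k) * num_trees (n - k)))) = card D" ..
  also have "\<dots> \<le> card (SIGMA E:T V. E)"
  proof (rule card_inj_on_le)
    show "inj_on J D"
      using KJ by (rule inj_on_inverseI)
    show "J ` D \<subseteq> (SIGMA E:T V. E)"
      using JD by blast
    show "finite (SIGMA E:T V. E)"
      using fin finE by auto
  qed
  also have "\<dots> = (\<Sum>E\<in>T V. card E)"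
    using fin finE by (intro card_SigmaI) auto
  also have "\<dots> \<le> (\<Sum>E\<in>T V. 2 * n)"
    by (intro sum_mono) (use card_tree_rel_le[of V] in \<open>auto simp: T_def\<close>)
  also have "\<dots> = 2 * (n * num_trees n)"
    by (simp add: card_T)
  finally show ?thesis .
qed

subsection \<open>Convergence of the pointed series\<close>

text \<open>By the Cauchy product the sum \<open>S\<close> satisfies
  \<open>S * S \<le> c * S\<close>, and a positive \<open>S\<close> can be cancelled.\<close>

lemma suminf_le_if_convolution_le:
  fixes a :: "nat \<Rightarrow> real"
  assumes nonneg: "\<And>n. a n \<ge> 0" and conv: "\<And>n. (\<Sum>k\<le>n. a k * a (n - k)) \<le> c * a n"
    and sm: "summable a" and c: "c \<ge> 0"
  shows "suminf a \<le> c"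
proof -
  have na: "summable (\<lambda>n. norm (a n))"
    using sm nonneg by simp
  have "(\<Sum>n. a n) * (\<Sum>n. a n) = (\<Sum>n. \<Sum>k\<le>n. a k * a (n - k))"
    by (rule Cauchy_product[OF na na])
  also have "\<dots> \<le> (\<Sum>n. c * a n)"
    using conv summable_Cauchy_product[OF na na] sm by (intro suminf_le summable_mult)
  also have "\<dots> = c * (\<Sum>n. a n)"
    using sm by (rule suminf_mult)
  finally have "suminf a * suminf a \<le> c * suminf a" .
  moreover have "suminf a \<ge> 0"
    using sm nonneg by (rule suminf_nonneg)
  ultimately show ?thesis
    using c by (cases "suminf a = 0") auto
qed

text \<open>Each partial sum is continuous in \<open>x\<close>, so the bound \<open>M\<close> passes
  to \<open>r\<close>; nonnegative terms with bounded partial sums are summable.\<close>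

lemma summable_boundary:
  fixes a :: "nat \<Rightarrow> real"
  assumes nonneg: "\<And>n. a n \<ge> 0" and r: "r > 0"
    and sm: "\<And>x. 0 \<le> x \<Longrightarrow> x < r \<Longrightarrow> summable (\<lambda>n. a n * x ^ n)"
    and bound: "\<And>x. 0 \<le> x \<Longrightarrow> x < r \<Longrightarrow> (\<Sum>n. a n * x ^ n) \<le> M"
  shows "summable (\<lambda>n. a n * r ^ n)"
proof (rule bounded_imp_summable)
  fix N
  have "((\<lambda>x. \<Sum>n\<le>N. a n * x ^ n) \<longlongrightarrow> (\<Sum>n\<le>N. a n * r ^ n)) (at_left r)"
    by (intro tendsto_intros)
  moreover have "\<forall>\<^sub>F x in at_left r. (\<Sum>n\<le>N. a n * x ^ n) \<le> M"
    using eventually_at_left_real[OF r]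
  proof eventually_elim
    case (elim x)
    then have "(\<Sum>n\<le>N. a n * x ^ n) \<le> (\<Sum>n. a n * x ^ n)"
      using sm[of x] nonneg by (intro sum_le_suminf) auto
    also have "\<dots> \<le> M"
      using bound[of x] elim by auto
    finally show ?case .
  qed
  ultimately show "(\<Sum>n\<le>N. a n * r ^ n) \<le> M"
    using tendsto_upperbound trivial_limit_at_left_real by blast
qed (use nonneg r in auto)

section \<open>The tree series and its value at the radius of convergence\<close>

lemma egf_trees_nth: "fps_nth (egf trees) n = num_trees n / fact n"
proof -
  have "bij_betw parcs {G \<in> trees. pverts G = {1..n}} {E. tree_rel {1..n} E}"
    by (rule bij_betwI[where g = "\<lambda>E. \<lparr>pverts = {1..n}, parcs = E\<rparr>"])
      (auto simp: trees_iff_tree_rel)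
  then show ?thesis
    by (simp add: egf_def num_trees_def bij_betw_same_card)
qed

lemma pointed_egf_trees_nth: "fps_nth (pointed_egf trees) n = n * num_trees n / fact n"
proof (cases n)
  case (Suc m)
  have "1 + real m \<noteq> 0"
    by linarith
  with Suc show ?thesis
    by (simp add: pointed_egf_def egf_trees_nth field_simps)
qed (simp add: pointed_egf_def)

text \<open>Division by \<open>fact n\<close> turns the binomial coefficient into the factor
  \<open>1 / (fact k * fact (n - k))\<close> of the exponential series.\<close>

lemma pointed_egf_trees_convolution:
  "(\<Sum>k\<le>n. fps_nth (pointed_egf trees) k * fps_nth (pointed_egf trees) (n - k))
     \<le> 2 * fps_nth (pointed_egf trees) n"
proof -
  have "fps_nth (pointed_egf trees) k * fps_nth (pointed_egf trees) (n - k) =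
      real ((n choose k) * (k * num_trees k * ((n - k) * num_trees (n - k)))) / fact n"
    if "k \<le> n" for k
    using that by (simp add: pointed_egf_trees_nth binomial_fact field_simps)
  then have "(\<Sum>k\<le>n. fps_nth (pointed_egf trees) k * fps_nth (pointed_egf trees) (n - k)) =
      real (\<Sum>k\<le>n. (n choose k) * (k * num_trees k * ((n - k) * num_trees (n - k)))) / fact n"
    by (simp add: sum_divide_distrib)
  also have "\<dots> \<le> real (2 * (n * num_trees n)) / fact n"
    by (intro divide_right_mono of_nat_mono num_trees_convolution) simp
  finally show ?thesis
    by (simp add: pointed_egf_trees_nth)
qed

lemma num_trees_1: "num_trees (Suc 0) = 1"
proof -
  have "E = {}" if "tree_rel {Suc 0} E" for E
    using tree_relD(3)[OF that] tree_rel_irrefl[OF that] by fastforce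
  moreover have "tree_rel {Suc 0} {}"
    by (simp add: tree_rel_def sym_def)
  ultimately have "{E. tree_rel {1..Suc 0} E} = {{}}"
    by auto
  then show ?thesis
    by (simp add: num_trees_def)
qed

text \<open>The lower bound is the linear term alone, from the one-vertex tree. The upper bound is
  the convolution inequality, scaled by \<open>x ^ n\<close>.\<close>

lemma pointed_egf_trees_bounds:
  assumes x: "0 \<le> x" and sm: "summable (\<lambda>n. fps_nth (pointed_egf trees) n * x ^ n)"
  shows "x \<le> eval_fps (pointed_egf trees) x" "eval_fps (pointed_egf trees) x \<le> 2"
proof -
  let ?a = "\<lambda>n. fps_nth (pointed_egf trees) n * x ^ n"
  have nonneg: "?a n \<ge> 0" for n
    using x by (simp add: pointed_egf_trees_nth)
  have "(\<Sum>k\<le>n. ?a k * ?a (n - k)) \<le> 2 * ?a n" for n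
  proof -
    have "(\<Sum>k\<le>n. ?a k * ?a (n - k)) =
        (\<Sum>k\<le>n. fps_nth (pointed_egf trees) k * fps_nth (pointed_egf trees) (n - k)) * x ^ n"
      unfolding sum_distrib_right
    proof (intro sum.cong refl)
      fix k assume "k \<in> {..n}"
      then have "x ^ n = x ^ k * x ^ (n - k)"
        by (simp flip: power_add)
      then show "?a k * ?a (n - k) =
          fps_nth (pointed_egf trees) k * fps_nth (pointed_egf trees) (n - k) * x ^ n"
        by simp
    qed
    also have "\<dots> \<le> 2 * fps_nth (pointed_egf trees) n * x ^ n"
      using x by (intro mult_right_mono pointed_egf_trees_convolution) simp
    finally show ?thesis by simp
  qed
  then show "eval_fps (pointed_egf trees) x \<le> 2"
    unfolding eval_fps_def by (intro suminf_le_if_convolution_le nonneg sm) auto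
  have "sum ?a {1} \<le> suminf ?a"
    using sm nonneg by (intro sum_le_suminf) auto
  then show "x \<le> eval_fps (pointed_egf trees) x"
    by (simp add: eval_fps_def pointed_egf_trees_nth num_trees_1)
qed

text \<open>Since \<open>n ^ n / fact n\<close> is a single term of the series for
  \<open>exp n\<close>, the terms at \<open>exp (-2)\<close> are dominated by the geometric series
  of \<open>exp (-1)\<close>.\<close>

lemma egf_trees_conv_radius_pos: "fps_conv_radius (egf trees) > 0"
proof -
  have bound: "norm (fps_nth (egf trees) n * exp (-2) ^ n) \<le> exp (-1) ^ n" for n
  proof -
    have "real n ^ n / fact n \<le> exp (real n)"
    proof -
      have "real n ^ n /\<^sub>R fact n \<le> (\<Sum>k. real n ^ k /\<^sub>R fact k)"
        using sum_le_suminf[OF summable_exp_generic[of "real n"], of "{n}"] by simp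
      then show ?thesis
        by (simp add: exp_def field_simps)
    qed
    moreover have "real (num_trees n) \<le> real n ^ n"
      using num_trees_le[of n] by (metis of_nat_le_iff of_nat_power)
    ultimately have "real (num_trees n) / fact n \<le> exp (real n)"
      by (meson divide_right_mono fact_ge_zero order_trans)
    then have "real (num_trees n) / fact n * exp (-2) ^ n \<le> exp (real n) * exp (-2) ^ n"
      by (intro mult_right_mono) auto
    also have "\<dots> = exp (-1) ^ n"
      by (simp flip: exp_of_nat_mult exp_add)
    finally show ?thesis
      by (simp add: egf_trees_nth)
  qed
  have "summable (\<lambda>n. exp (-1 :: real) ^ n)"
    by (rule summable_geometric) simp
  then have "summable (\<lambda>n. fps_nth (egf trees) n * exp (-2) ^ n)"
    using bound by (rule summable_comparison_test'[where N = 0]) 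
  then have "fps_conv_radius (egf trees) \<ge> norm (exp (-2) :: real)"
    unfolding fps_conv_radius_def by (rule conv_radius_geI)
  moreover have "ereal (norm (exp (-2) :: real)) > 0"
    by simp
  ultimately show ?thesis
    by (metis less_le_trans)
qed

lemma block_param_trees_pos: "block_param trees > 0"
proof -
  let ?T = "pointed_egf trees"
  define R where "R = fps_conv_radius (egf trees)"
  have "R \<le> fps_conv_radius ?T"
    using fps_conv_radius_mult[of fps_X "fps_deriv (egf trees)"] fps_conv_radius_deriv[of "egf trees"]
    by (simp add: R_def pointed_egf_def)
  then have sm: "summable (\<lambda>n. fps_nth ?T n * x ^ n)" if "0 \<le> x" "ereal x < R" for x
    using that by (intro summable_fps) auto
  \<comment> \<open>A point \<open>x\<close> with \<open>2 < x < R\<close> would violate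
    \<open>x \<le> T(x) \<le> 2\<close>.\<close>
  have "R \<le> ereal 2"
  proof (rule ccontr)
    assume "\<not> R \<le> ereal 2"
    then obtain x where "ereal x < R" "2 < x"
      using ereal_dense2[of "ereal 2" R] by (auto simp: not_le)
    then show False
      using pointed_egf_trees_bounds[OF _ sm, of x] by auto
  qed
  moreover have "R > 0"
    unfolding R_def by (rule egf_trees_conv_radius_pos)
  \<comment> \<open>Finiteness of \<open>R\<close> matters: \<open>real_of_ereal\<close> would turn
    an infinite radius into \<open>0\<close>.\<close>
  ultimately obtain r where r: "R = ereal r" "r > 0"
    by (cases R) auto
  \<comment> \<open>Convergence at \<open>r\<close> itself is what gives the value of
    \<open>eval_fps\<close> there its meaning as a sum.\<close>
  have "summable (\<lambda>n. fps_nth ?T n * r ^ n)"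
  proof (rule summable_boundary[OF _ r(2)])
    fix x assume x: "0 \<le> x" "x < r"
    then show "summable (\<lambda>n. fps_nth ?T n * x ^ n)"
      by (intro sm) (simp_all add: r)
    with x(1) show "(\<Sum>n. fps_nth ?T n * x ^ n) \<le> 2"
      using pointed_egf_trees_bounds(2) by (simp add: eval_fps_def)
  qed (simp add: pointed_egf_trees_nth)
  then have "r \<le> eval_fps ?T r"
    using r(2) by (intro pointed_egf_trees_bounds(1)) simp_all
  with r show ?thesis
    by (simp add: block_param_def egf_radius_def flip: R_def)
qed

subsection \<open>The Boltzmann distribution\<close>

text \<open>Thus \<open>B(z) = z^2 / 2\<close>: both orders of the ends \<open>1\<close> and
  \<open>2\<close> give the same edge.\<close>

lemma egf_blocks_trees_nth: "fps_nth (egf (blocks trees)) n = (if n = 2 then 1 / 2 else 0)"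
proof (cases "n = 2")
  case True
  have 12: "{1..2} = {1, 2 :: nat}"
    by auto
  have "{G \<in> blocks trees. pverts G = {1..n}} = {\<lparr>pverts = {1, 2}, parcs = {(1, 2), (2, 1)}\<rparr>}"
  proof (intro equalityI subsetI)
    fix G assume "G \<in> {G \<in> blocks trees. pverts G = {1..n}}"
    then obtain u v where G: "G = \<lparr>pverts = {u, v}, parcs = {(u, v), (v, u)}\<rparr>" "pverts G = {1, 2}"
      unfolding blocks_trees True 12 by blast
    then have "{u, v} = {1, 2}"
      by simp
    with G(1) show "G \<in> {\<lparr>pverts = {1, 2}, parcs = {(1, 2), (2, 1)}\<rparr>}"
      by (auto simp: doubleton_eq_iff)
  next
    fix G :: lgraph assume "G \<in> {\<lparr>pverts = {1, 2}, parcs = {(1, 2), (2, 1)}\<rparr>}"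
    then show "G \<in> {G \<in> blocks trees. pverts G = {1..n}}"
      unfolding blocks_trees True 12 by fastforce
  qed
  then show ?thesis
    using True by (simp add: egf_def fact_numeral)
next
  case False
  have "card {u, v} = 2" if "u \<noteq> v" for u v :: nat
    using that by simp
  then have "{u, v} \<noteq> {1..n}" if "u \<noteq> v" for u v
    using False that by (metis card_atLeastAtMost diff_Suc_1)
  then have empty: "{G \<in> blocks trees. pverts G = {1..n}} = {}"
    by (auto simp: blocks_trees)
  show ?thesis
    unfolding egf_def fps_nth_Abs_fps empty using False by simp
qed

lemma derived_pointed_block_egf_trees: "derived_pointed_block_egf trees = fps_X"
proof (rule fps_ext)
  fix n show "fps_nth (derived_pointed_block_egf trees) n = fps_nth fps_X n"
    by (cases n) (auto simp: derived_pointed_block_egf_def egf_blocks_trees_nth)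
qed

definition root_edge :: "lgraph \<times> nat" where
  "root_edge = (\<lparr>pverts = {0, 1}, parcs = {(0, 1), (1, 0)}\<rparr>, 1)"

text \<open>An edge has two vertices while \<open>insert 0 {1..m}\<close> has \<open>m + 1\<close>,
  so \<open>m = 1\<close> and the root can only be \<open>1\<close>.\<close>

lemma derived_pointed_blocks_trees:
  "(\<Union>m. derived_pointed_blocks trees {1..m}) = {root_edge}"
proof (intro equalityI subsetI)
  fix X assume "X \<in> (\<Union>m. derived_pointed_blocks trees {1..m})"
  then obtain m u v r where X: "X = (\<lparr>pverts = {u, v}, parcs = {(u, v), (v, u)}\<rparr>, r)"
    and uv: "u \<noteq> v" "{u, v} = insert 0 {1..m}" and r: "r \<in> {1..m}"
    by (auto simp: derived_pointed_blocks_def blocks_trees)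
  have "m = 1"
    using arg_cong[OF uv(2), of card] uv(1) by simp
  with X uv r show "X \<in> {root_edge}"
    by (auto simp: root_edge_def doubleton_eq_iff)
next
  fix X assume "X \<in> {root_edge}"
  then have "X \<in> derived_pointed_blocks trees {1..1}"
    by (force simp: derived_pointed_blocks_def blocks_trees root_edge_def)
  then show "X \<in> (\<Union>m. derived_pointed_blocks trees {1..m})"
    by blast
qed

lemma obj_size_root_edge: "obj_size root_edge = 1"
  by (simp add: obj_size_def root_edge_def)

lemma sp_root_edge: "sp root_edge = 1"
proof -
  let ?G = "\<lparr>pverts = {0, 1 :: nat}, parcs = {(0, 1), (1, 0)}\<rparr>"
  interpret pair_wf_digraph ?G
    by unfold_locales auto
  have "awalk 0 [(0, 1)] 1"
    by (simp add: awalk_simps del: One_nat_def)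
  moreover have "length p \<noteq> 0" if "awalk 0 p 1" for p
    using that by (auto simp: awalk_simps simp del: One_nat_def)
  ultimately have "(LEAST n. \<exists>p. awalk 0 p 1 \<and> length p = n) = 1"
    by (intro Least_equality exI[of _ "[(0, 1)]"]) (auto simp: Suc_le_eq)
  then show ?thesis
    by (simp add: sp_def root_edge_def graph_dist_def)
qed

text \<open>The only object has weight \<open>y / (1 * y) = 1\<close>, so the distribution is a
  point mass. Positivity of \<open>y\<close> allows the cancellation.\<close>

lemma integral_boltzmann_trees:
  fixes f :: "lgraph \<times> nat \<Rightarrow> real"
  assumes "y > 0"
  shows "(\<integral>X. f X \<partial>boltzmann trees y) = f root_edge"
proof -
  have "(\<integral>X. f X \<partial>boltzmann trees y) =
      (\<integral>X. (y ^ obj_size X / (fact (obj_size X) * y)) *\<^sub>R f X \<partial>count_space {root_edge})"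
    unfolding boltzmann_def derived_pointed_blocks_trees derived_pointed_block_egf_trees eval_fps_X
    using assms by (intro integral_density) auto
  also have "\<dots> = f root_edge"
    using assms by (simp add: lebesgue_integral_count_space_finite obj_size_root_edge)
  finally show ?thesis .
qed

theorem proposition8p1:
  shows "scaling_factor trees = 1 \<and> sigma_squared trees = 1"
  by (simp add: scaling_factor_def sigma_squared_def integral_boltzmann_trees
      block_param_trees_pos sp_root_edge obj_size_root_edge)

end
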